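(* The maximum number of removable edges of a Skolem circle of order $m$ is $O(\log m)$; that is, there is a constant $K$ such that for every $m\ge 2$, every Skolem circle of order $m$ has at most $K\log m$ removable edges.
   Context: Let $C_{2m}$ be the cycle graph with vertices $v_1,\dots,v_{2m}$ in cyclic order. A Skolem circle of order $m$ is a labelling of the vertices of $C_{2m}$ by labels from $\{1,\dots,m\}$ such that each label is used exactly twice and any two vertices with the same label $s$ are at distance exactly $s$ in $C_{2m}$. An edge $e$ of $C_{2m}$ is removable if in the path $C_{2m}-e$ any two vertices with the same label $s$ are still at distance exactly $s$. *)

theory Defs
  imports Complex_Main "Graph_Theory.Graph_Theory"
begin

text \<open>
  Undirected simple graphs are symmetric loopless pair digraphs (locale \<open>pair_graph\<close>): an
  undirected edge \<open>{u, v}\<close> is represented by the two arcs \<open>(u, v)\<close> and \<open>(v, u)\<close>, so deleting an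
  edge deletes both arcs.
\<close>

definition edges :: "'a pair_pre_digraph \<Rightarrow> 'a set set" where
  "edges G = {{u, v} | u v. (u, v) \<in> parcs G}"

definition delete_edge :: "'a pair_pre_digraph \<Rightarrow> 'a set \<Rightarrow> 'a pair_pre_digraph" where
  "delete_edge G e = \<lparr> pverts = pverts G, parcs = {(u, v) \<in> parcs G. {u, v} \<noteq> e} \<rparr>"

text \<open>The distance is infinite if there is no walk from \<open>u\<close> to \<open>v\<close>.\<close>

definition graph_dist :: "'a pair_pre_digraph \<Rightarrow> 'a \<Rightarrow> 'a \<Rightarrow> ereal" where
  "graph_dist G u v = wf_digraph.\<mu> (with_proj G) (\<lambda>_. 1) u v"

text \<open>The vertex \<open>i\<close> stands for $v_{i+1}$. For \<open>n \<ge> 3\<close> this is the simple cycle on \<open>n\<close> vertices.\<close>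

definition cycle_graph :: "nat \<Rightarrow> nat pair_pre_digraph" where
  "cycle_graph n = \<lparr> pverts = {..<n},
     parcs = {(i, j). i < n \<and> j < n \<and> (j = (i + 1) mod n \<or> i = (j + 1) mod n)} \<rparr>"

definition labels_are_distances :: "'a pair_pre_digraph \<Rightarrow> ('a \<Rightarrow> nat) \<Rightarrow> bool" where
  "labels_are_distances G f \<longleftrightarrow>
     (\<forall>u\<in>pverts G. \<forall>v\<in>pverts G. u \<noteq> v \<and> f u = f v \<longrightarrow> graph_dist G u v = ereal (real (f u)))"

definition skolem_circle :: "nat \<Rightarrow> (nat \<Rightarrow> nat) \<Rightarrow> bool" where
  "skolem_circle m f \<longleftrightarrow>
     (\<forall>v\<in>pverts (cycle_graph (2 * m)). f v \<in> {1..m}) \<and>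
     (\<forall>s\<in>{1..m}. card {v \<in> pverts (cycle_graph (2 * m)). f v = s} = 2) \<and>
     labels_are_distances (cycle_graph (2 * m)) f"

definition removable_edges :: "nat \<Rightarrow> (nat \<Rightarrow> nat) \<Rightarrow> nat set set" where
  "removable_edges m f =
     {e \<in> edges (cycle_graph (2 * m)). labels_are_distances (delete_edge (cycle_graph (2 * m)) e) f}"

lemma pair_graph_cycle_graph:
  assumes "n \<ge> 3"
  shows "pair_graph (cycle_graph n)"
proof
  show "finite (parcs (cycle_graph n))"
    by (rule finite_subset[of _ "{..<n} \<times> {..<n}"]) (auto simp: cycle_graph_def)
  show "symmetric (with_proj (cycle_graph n))"
    by (auto simp: symmetric_def sym_def cycle_graph_def)
  fix e assume "e \<in> parcs (cycle_graph n)"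
  with assms show "fst e \<noteq> snd e"
    by (auto simp: cycle_graph_def mod_Suc split: if_splits)
qed (auto simp: cycle_graph_def)

lemma pair_graph_delete_edge:
  assumes "pair_graph G"
  shows "pair_graph (delete_edge G e)"
proof -
  interpret pair_graph G by fact
  show ?thesis
  proof
    show "finite (parcs (delete_edge G e))"
      by (rule finite_subset[OF _ pair_finite_arcs]) (auto simp: delete_edge_def)
    show "symmetric (with_proj (delete_edge G e))"
      using pair_sym_arcs by (auto simp: symmetric_def sym_def delete_edge_def insert_commute)
  qed (auto simp: delete_edge_def in_arcsD1 in_arcsD2 pair_finite_verts dest: pair_no_loops)
qed

lemma graph_dist_conv_walk_length:
  assumes "pair_wf_digraph G"
  shows "graph_dist G u v = (INF p\<in>{p. pre_digraph.awalk (with_proj G) u p v}. ereal (real (length p)))"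
proof -
  interpret pair_wf_digraph G by fact
  have "awalk_cost (\<lambda>_. 1) p = real (length p)" for p :: "('a \<times> 'a) list"
    by (induction p) auto
  then show ?thesis
    by (simp add: graph_dist_def \<mu>_def)
qed

end

theory Submission
  imports Defs
begin

text \<open>
  Apart from label \<open>m\<close>, no pair of equally labelled vertices is separated by a pair of removable
  edges, so the removable edges cut the circle into blocks that, with at most two exceptions plus
  one block through vertex \<open>0\<close>, are unions of such pairs. A block with \<open>k\<close> pairs has label sum at
  most \<open>k\<^sup>2\<close>. On the other hand the labels of different blocks are distinct, so blocks with \<open>K\<close>
  pairs in total and at most \<open>k\<close> pairs each satisfy \<open>K (K + 1) / 2 \<le> k K\<close>. Hence the largest of
  any family of blocks contains more pairs than all the others together, and \<open>r\<close> blocks contain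
  at least \<open>2\<^sup>r - 1\<close> labels.
\<close>

subsection \<open>Disjoint sets of positive integers with small sums\<close>

text \<open>Induction on the maximum \<open>b\<close>: a set of \<open>n\<close> positive integers
  bounded by \<open>b\<close> has \<open>n \<le> b\<close>, so adding \<open>b\<close> raises the
  doubled sum by at least \<open>2 * n\<close>, which is the growth of
  \<open>n * (n + 1)\<close>.\<close>

lemma sum_distinct_pos_ge:
  fixes S :: "nat set"
  assumes "finite S" "0 \<notin> S"
  shows "card S * (card S + 1) \<le> 2 * \<Sum>S"
  using assms
proof (induction rule: finite_linorder_max_induct)
  case (insert b A)
  have "insert b A \<subseteq> {1..b}"
    using insert.hyps insert.prems by (force simp: Suc_le_eq intro: gr0I)
  then have "card (insert b A) \<le> b"
    using card_mono[of "{1..b}"] by fastforce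
  moreover have "b \<notin> A"
    using insert.hyps by auto
  ultimately show ?case
    using insert by (simp add: algebra_simps)
qed simp

lemma two_power_card_le_sum_card:
  fixes S :: "'a \<Rightarrow> nat set"
  assumes "finite T"
    and "\<And>b. b \<in> T \<Longrightarrow> finite (S b) \<and> S b \<noteq> {} \<and> 0 \<notin> S b \<and> \<Sum>(S b) \<le> (card (S b))\<^sup>2"
    and "disjoint_family_on S T"
  shows "2 ^ card T \<le> (\<Sum>b\<in>T. card (S b)) + 1"
  using assms
\<comment> \<open>Sets are added in order of cardinality, so \<open>S b\<close> is a largest one
  among those present; the rule leaves open whether \<open>b\<close> is already in
  \<open>T\<close>.\<close>
proof (induction T rule: finite_ranking_induct[where f = "\<lambda>b. card (S b)"])
  case (insert b T)
  show ?case
  proof (cases "b \<in> T")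
    case True
    with insert show ?thesis
      by (simp add: insert_absorb)
  next
    case False
    let ?T = "insert b T" and ?k = "card (S b)"
    let ?K = "\<Sum>c\<in>?T. card (S c)"
    have fin: "finite ?T"
      using insert.hyps by simp
    have disj: "\<forall>i\<in>?T. \<forall>j\<in>?T. i \<noteq> j \<longrightarrow> S i \<inter> S j = {}"
      using insert.prems(2) by (auto simp: disjoint_family_on_def)
    have card_U: "card (\<Union>c\<in>?T. S c) = ?K"
      using fin insert.prems(1) disj by (intro card_UN_disjoint) auto
    have sum_U: "\<Sum>(\<Union>c\<in>?T. S c) = (\<Sum>c\<in>?T. \<Sum>(S c))"
      using fin insert.prems(1) disj by (intro sum.UNION_disjoint) auto
    have "?K * (?K + 1) \<le> 2 * \<Sum>(\<Union>c\<in>?T. S c)"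
      unfolding card_U[symmetric] using fin insert.prems(1)
      by (intro sum_distinct_pos_ge) auto
    also have "\<dots> \<le> 2 * (\<Sum>c\<in>?T. card (S c) * ?k)"
      unfolding sum_U
    proof (intro mult_le_mono2 sum_mono)
      fix c assume c: "c \<in> ?T"
      then have "\<Sum>(S c) \<le> card (S c) * card (S c)"
        using insert.prems(1) by (simp add: power2_eq_square)
      also have "\<dots> \<le> card (S c) * ?k"
        using c insert.hyps by auto
      finally show "\<Sum>(S c) \<le> card (S c) * ?k" .
    qed
    also have "\<dots> = ?K * (2 * ?k)"
      by (simp add: sum_distrib_right[symmetric])
    finally have "?K * (?K + 1) \<le> ?K * (2 * ?k)" .
    moreover have "?K > 0"
      using insert.prems(1)[of b] insert.hyps(1) False by (simp add: card_gt_0_iff)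
    \<comment> \<open>As \<open>?K\<close> is \<open>?k\<close> plus the remaining cardinalities,
      \<open>?k\<close> exceeds the sum of the others, so adding \<open>S b\<close> at least doubles
      the total plus 1.\<close>
    ultimately have "?K + 1 \<le> 2 * ?k"
      by (simp only: mult_le_cancel1)
    moreover have "2 ^ card T \<le> (\<Sum>c\<in>T. card (S c)) + 1"
      using insert.prems by (intro insert.IH) (auto simp: disjoint_family_on_def)
    ultimately show ?thesis
      using False insert.hyps(1) by simp
  qed
qed simp

subsection \<open>Distances in a cycle with a deleted edge\<close>

text \<open>Each arc changes the potential \<open>h\<close> by at most 1, so every walk from
  \<open>u\<close> to \<open>v\<close> has length at least the difference of the potentials.\<close>

lemma graph_dist_ge:
  fixes h :: "'a \<Rightarrow> real"
  assumes "pair_wf_digraph G" "\<And>x y. (x, y) \<in> parcs G \<Longrightarrow> \<bar>h x - h y\<bar> \<le> 1"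
  shows "ereal \<bar>h u - h v\<bar> \<le> graph_dist G u v"
proof -
  interpret pair_wf_digraph G by fact
  have *: "\<bar>h w - h v\<bar> \<le> real (length p)" if "awalk w p v" for w p
    using that
  proof (induction p arbitrary: w)
    case (Cons a p)
    then have a: "a \<in> parcs G" "fst a = w" "awalk (snd a) p v"
      by (auto simp: awalk_Cons_iff)
    then have "\<bar>h w - h (snd a)\<bar> \<le> 1"
      using assms(2)[of w "snd a"] by (cases a) auto
    with Cons.IH[OF a(3)] show ?case
      by simp
  qed (auto simp: awalk_Nil_iff)
  show ?thesis
    unfolding graph_dist_conv_walk_length[OF assms(1)] by (intro INF_greatest) (auto intro: *)
qed

lemma cycle_graph_dist_le:
  assumes "n \<ge> 3" "u + d < n"
  shows "graph_dist (cycle_graph n) u (u + d) \<le> ereal (real d)"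
proof -
  interpret pair_graph "cycle_graph n"
    using assms by (intro pair_graph_cycle_graph)
  have "\<exists>p. awalk u p (u + d) \<and> length p = d"
    using assms(2)
  proof (induction d)
    case 0
    then have "u \<in> pverts (cycle_graph n)"
      by (simp add: cycle_graph_def)
    then show ?case
      by (simp add: awalk_Nil_iff)
  next
    case (Suc d)
    then obtain p where p: "awalk u p (u + d)" "length p = d"
      by auto
    have "(u + d, u + Suc d) \<in> parcs (cycle_graph n)"
      using Suc.prems by (simp add: cycle_graph_def)
    then have "awalk (u + d) [(u + d, u + Suc d)] (u + Suc d)"
      using in_arcsD2 by (simp add: awalk_Cons_iff awalk_Nil_iff)
    from awalk_appendI[OF p(1) this] p(2) show ?case
      by (intro exI[of _ "p @ [(u + d, u + Suc d)]"]) simp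
  qed
  then obtain p where "awalk u p (u + d)" "length p = d"
    by blast
  then show ?thesis
    unfolding graph_dist_conv_walk_length[OF local.pair_wf_digraph_axioms]
    by (intro INF_lower2[of p]) auto
qed

text \<open>
  The deleted edge joins \<open>e\<close> and its successor; the potential \<open>h\<close> numbers the vertices of the
  remaining path.
\<close>

lemma dist_delete_edge_ge:
  assumes "n \<ge> 3" "e < n" "u < v" "v < n"
  defines "G \<equiv> delete_edge (cycle_graph n) {e, (e + 1) mod n}"
  shows "ereal (real (if u \<le> e \<and> e < v then n - (v - u) else v - u)) \<le> graph_dist G u v"
proof -
  define h :: "nat \<Rightarrow> real" where "h x = (if x \<le> e then real x + real n else real x)" for x
  interpret pair_graph G
    unfolding G_def using assms(1) by (intro pair_graph_delete_edge pair_graph_cycle_graph)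
  have "pair_wf_digraph G"
    by unfold_locales
  \<comment> \<open>For \<open>e < n - 1\<close> the shift by \<open>n\<close> turns the wrap-around
    edge into a step from \<open>n - 1\<close> to \<open>n\<close>, and the only jump is across the
    deleted edge. For \<open>e = n - 1\<close> every vertex is shifted and the wrap-around edge is
    the deleted one.\<close>
  moreover have "\<bar>h x - h y\<bar> \<le> 1" if "(x, y) \<in> parcs G" for x y
    using that assms(1,2)
    by (auto simp: G_def h_def delete_edge_def cycle_graph_def mod_Suc doubleton_eq_iff
        split: if_splits)
  ultimately have "ereal \<bar>h u - h v\<bar> \<le> graph_dist G u v"
    by (rule graph_dist_ge)
  then show ?thesis
    using assms(2-4) by (auto simp: h_def of_nat_diff algebra_simps split: if_splits)
qed

subsection \<open>Blocks between removable edges\<close>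

text \<open>The terms are \<open>k, ..., 1, 0, 1, ..., k - 1\<close>. In the induction the first and
  the last term contribute \<open>k + 1\<close> and \<open>k\<close>, the difference of consecutive
  squares.\<close>

lemma sum_abs_dist_midpoint:
  "(\<Sum>x\<in>{a..<a + 2 * k}. \<bar>int x - int (a + k)\<bar>) = (int k)\<^sup>2"
proof -
  have "(\<Sum>x\<in>{a..<a + 2 * k}. \<bar>int x - int (a + k)\<bar>) = (\<Sum>i<2 * k. \<bar>int i - int k\<bar>)"
    by (rule sum.reindex_bij_witness[of _ "\<lambda>i. i + a" "\<lambda>x. x - a"]) auto
  also have "\<dots> = (int k)\<^sup>2"
  proof (induction k)
    case (Suc k)
    have "(\<Sum>i<2 * Suc k. \<bar>int i - int (Suc k)\<bar>)
        = \<bar>int 0 - int (Suc k)\<bar> + (\<Sum>i<Suc (2 * k). \<bar>int (Suc i) - int (Suc k)\<bar>)"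
      unfolding mult_Suc_right add_2_eq_Suc by (rule sum.lessThan_Suc_shift)
    then show ?case
      using Suc by (simp add: power2_eq_square algebra_simps)
  qed simp
  finally show ?thesis .
qed

text \<open>A removable edge is recorded by the index \<open>e\<close> before it in cyclic order, so
  that blocks between cuts become intervals \<open>{d<..e}\<close> of vertices.\<close>

definition cuts :: "nat \<Rightarrow> (nat \<Rightarrow> nat) \<Rightarrow> nat set" where
  "cuts m f = {e. e < 2 * m \<and>
     labels_are_distances (delete_edge (cycle_graph (2 * m)) {e, (e + 1) mod (2 * m)}) f}"

lemma card_removable_edges_le: "card (removable_edges m f) \<le> card (cuts m f)"
proof (rule surj_card_le)
  show "finite (cuts m f)"
    by (simp add: cuts_def)
  show "removable_edges m f \<subseteq> (\<lambda>e. {e, (e + 1) mod (2 * m)}) ` cuts m f"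
    by (auto simp: removable_edges_def cuts_def edges_def cycle_graph_def image_def insert_commute)
qed

locale skolem =
  fixes m :: nat and f :: "nat \<Rightarrow> nat"
  assumes m_ge_2: "m \<ge> 2" and skolem: "skolem_circle m f"
begin

lemma f_in: "x < 2 * m \<Longrightarrow> f x \<in> {1..m}"
  using skolem by (auto simp: skolem_circle_def cycle_graph_def)

lemma card_fibre: "s \<in> {1..m} \<Longrightarrow> card {x. x < 2 * m \<and> f x = s} = 2"
  using skolem by (auto simp: skolem_circle_def cycle_graph_def)

lemma label_le_diff:
  assumes "u < v" "v < 2 * m" "f u = f v"
  shows "f u \<le> v - u"
proof -
  have "graph_dist (cycle_graph (2 * m)) u v = ereal (real (f u))"
    using skolem assms by (auto simp: skolem_circle_def labels_are_distances_def cycle_graph_def)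
  with cycle_graph_dist_le[of "2 * m" u "v - u"] show ?thesis
    using m_ge_2 assms by simp
qed

text \<open>Once the edge at \<open>e\<close> is deleted, the only path from \<open>u\<close> to
  \<open>v\<close> is the arc avoiding it, and its length still has to be the label.\<close>

lemma label_ge_cut:
  assumes "e \<in> cuts m f" "u < v" "v < 2 * m" "f u = f v"
  shows "(if u \<le> e \<and> e < v then 2 * m - (v - u) else v - u) \<le> f u"
proof -
  have "graph_dist (delete_edge (cycle_graph (2 * m)) {e, (e + 1) mod (2 * m)}) u v
      = ereal (real (f u))"
    using assms by (auto simp: cuts_def labels_are_distances_def delete_edge_def cycle_graph_def)
  with dist_delete_edge_ge[of "2 * m" e u v] show ?thesis
    using m_ge_2 assms unfolding cuts_def by simp
qed

text \<open>The two cuts lie on different arcs between \<open>u\<close> and \<open>v\<close>, so the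
  label is at least both arc lengths. These add up to \<open>2 * m\<close>, while labels are at most
  \<open>m\<close>.\<close>

lemma separated_label_eq_m:
  assumes "d \<in> cuts m f" "e \<in> cuts m f" "u < v" "v < 2 * m" "f u = f v"
    and "u \<le> d \<and> d < v" "\<not> (u \<le> e \<and> e < v)"
  shows "f u = m"
  using label_ge_cut[of d u v] label_ge_cut[of e u v] f_in[of u] assms by auto

text \<open>If \<open>v\<close> lay outside the block, exactly one of the cuts \<open>d\<close> and
  \<open>e\<close> would fall between \<open>u\<close> and \<open>v\<close>, forcing the label
  \<open>m\<close>.\<close>

lemma partner_in_block:
  assumes "d \<in> cuts m f" "e \<in> cuts m f" "u \<in> {d<..e}" "v < 2 * m" "f u = f v" "f u \<noteq> m"
  shows "v \<in> {d<..e}"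
proof (rule ccontr)
  assume v: "v \<notin> {d<..e}"
  have "u < 2 * m"
    using assms(2,3) by (auto simp: cuts_def)
  show False
  proof (cases u v rule: linorder_cases)
    case less
    with v assms show False
      using separated_label_eq_m[of e d u v] by auto
  next
    case greater
    with v assms \<open>u < 2 * m\<close> show False
      using separated_label_eq_m[of d e v u] by auto
  qed (use v assms in auto)
qed

text \<open>The block consists of \<open>k\<close> full pairs. A label is at most the difference of
  its two positions, hence at most the sum of their distances to the midpoint \<open>c\<close> of
  the block; summed over all \<open>2 * k\<close> positions these distances give the square of
  \<open>k\<close>.\<close>

lemma block_sum_le:
  assumes de: "d \<in> cuts m f" "e \<in> cuts m f" and no_m: "m \<notin> f ` {d<..e}"
  shows "\<Sum>(f ` {d<..e}) \<le> (card (f ` {d<..e}))\<^sup>2"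
proof -
  let ?B = "{d<..e}"
  define F where "F s = {x. x < 2 * m \<and> f x = s}" for s
  have e: "e < 2 * m"
    using de by (simp add: cuts_def)
  have F_sub: "F s \<subseteq> ?B" and F_card: "card (F s) = 2" if "s \<in> f ` ?B" for s
  proof -
    from that obtain u where u: "u \<in> ?B" "s = f u"
      by blast
    have "f u \<noteq> m"
      using u(1) no_m by blast
    then show "F s \<subseteq> ?B"
      using partner_in_block[OF de u(1)] u(2) by (auto simp: F_def simp del: greaterThanAtMost_iff)
    show "card (F s) = 2"
      using u e f_in[of u] card_fibre[of s] by (simp add: F_def)
  qed
  have B: "?B = (\<Union>s\<in>f ` ?B. F s)"
    using F_sub e by (auto simp: F_def)
  have disj: "\<forall>s\<in>f ` ?B. \<forall>t\<in>f ` ?B. s \<noteq> t \<longrightarrow> F s \<inter> F t = {}"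
    by (auto simp: F_def)
  have fin: "finite (F s)" for s
    by (simp add: F_def)
  define k where "k = card (f ` ?B)"
  have "card ?B = (\<Sum>s\<in>f ` ?B. card (F s))"
    by (subst B, rule card_UN_disjoint) (use fin disj in auto)
  also have "\<dots> = 2 * k"
    using F_card by (simp add: k_def)
  finally have B_eq: "?B = {Suc d..<Suc d + 2 * k}"
    by auto
  define c where "c = Suc d + k"
  have "int (\<Sum>(f ` ?B)) = (\<Sum>s\<in>f ` ?B. int s)"
    by simp
  also have "\<dots> \<le> (\<Sum>s\<in>f ` ?B. \<Sum>x\<in>F s. \<bar>int x - int c\<bar>)"
  proof (rule sum_mono)
    fix s assume "s \<in> f ` ?B"
    then have "card (F s) = 2"
      by (rule F_card)
    then obtain u v where uv: "F s = {u, v}" "u < v"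
      by (metis card_2_iff insert_commute linorder_neqE_nat)
    then have "u \<in> F s" "v \<in> F s"
      by auto
    then have "s \<le> v - u"
      using label_le_diff[of u v] uv(2) by (simp add: F_def)
    with uv show "int s \<le> (\<Sum>x\<in>F s. \<bar>int x - int c\<bar>)"
      by auto
  qed
  also have "\<dots> = (\<Sum>x\<in>?B. \<bar>int x - int c\<bar>)"
    by (subst (2) B, rule sum.UNION_disjoint[symmetric]) (use fin disj in auto)
  also have "\<dots> = (int k)\<^sup>2"
    by (simp only: c_def B_eq sum_abs_dist_midpoint)
  finally have "int (\<Sum>(f ` ?B)) \<le> int (k\<^sup>2)"
    by (simp only: of_nat_power)
  then show ?thesis
    by (simp only: of_nat_le_iff k_def)
qed

text \<open>Of the loss of 3, one is for the largest cut, which starts no block ending at a later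
  cut, and two are for the blocks that may contain a vertex labelled \<open>m\<close>.\<close>

lemma two_power_card_cuts_le: "2 ^ (card (cuts m f) - 3) \<le> m + 1"
proof -
  let ?E = "cuts m f"
  have finE: "finite ?E"
    by (simp add: cuts_def)
  \<comment> \<open>For the largest cut this is the minimum of an empty set, so \<open>nxt\<close>
    is meaningful only on \<open>E'\<close>.\<close>
  define nxt where "nxt d = Min {e \<in> ?E. d < e}" for d
  define B where "B d = {d<..nxt d}" for d
  define E' where "E' = ?E - {Max ?E}"
  have finE': "finite E'"
    using finE by (simp add: E'_def)
  have nxt: "nxt d \<in> ?E \<and> d < nxt d" if "d \<in> E'" for d
  proof -
    have "Max ?E \<in> {e \<in> ?E. d < e}"
      using that finE Max_in[of ?E] Max_ge[of ?E d] by (auto simp: E'_def less_le simp del: Max_in)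
    then have "nxt d \<in> {e \<in> ?E. d < e}"
      unfolding nxt_def using finE Min_in[of "{e \<in> ?E. d < e}"] by fastforce
    then show ?thesis
      by simp
  qed
  have nxt_le: "nxt d \<le> e" if "e \<in> ?E" "d < e" for d e
    using that finE by (auto simp: nxt_def)
  have B_disj: "B d \<inter> B e = {}" if "d \<in> E'" "e \<in> E'" "d \<noteq> e" for d e
    using that nxt_le[of d e] nxt_le[of e d]
    by (cases d e rule: linorder_cases) (force simp: B_def E'_def)+
  have B_lt: "x < 2 * m" if "d \<in> E'" "x \<in> B d" for d x
    using nxt[OF that(1)] that(2) by (auto simp: B_def cuts_def)

  define M where "M = {d \<in> E'. m \<in> f ` B d}"
  define T where "T = E' - M"
  have "card M \<le> 2"
  proof -
    have "\<forall>d\<in>M. \<exists>x. x \<in> B d \<and> f x = m"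
      by (auto simp: M_def)
    \<comment> \<open>Choosing one vertex labelled \<open>m\<close> per block is injective, as
      blocks are disjoint, and only two such vertices exist.\<close>
    then obtain g where g: "\<And>d. d \<in> M \<Longrightarrow> g d \<in> B d \<and> f (g d) = m"
      by metis
    have "inj_on g M"
    proof (rule inj_onI)
      fix d e assume de: "d \<in> M" "e \<in> M" "g d = g e"
      then have "g d \<in> B d \<inter> B e"
        using g[of d] g[of e] by simp
      with de(1,2) show "d = e"
        using B_disj[of d e] unfolding M_def by blast
    qed
    moreover have "g ` M \<subseteq> {x. x < 2 * m \<and> f x = m}"
    proof (rule image_subsetI)
      fix d assume d: "d \<in> M"
      then have "d \<in> E'"
        by (simp add: M_def)
      then show "g d \<in> {x. x < 2 * m \<and> f x = m}"
        using g[OF d] B_lt[of d "g d"] by simp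
    qed
    ultimately have "card M \<le> card {x. x < 2 * m \<and> f x = m}"
      by (intro card_inj_on_le) auto
    then show ?thesis
      using card_fibre[of m] m_ge_2 by simp
  qed
  moreover have "card E' \<ge> card ?E - 1"
    unfolding E'_def using diff_card_le_card_Diff[of "{Max ?E}" ?E] by simp
  moreover have "card T = card E' - card M"
    unfolding T_def by (rule card_Diff_subset) (use finE' in \<open>auto simp: M_def\<close>)
  ultimately have card_T: "card ?E - 3 \<le> card T"
    by linarith

  \<comment> \<open>A label shared by two blocks would, since it is not \<open>m\<close>, place a
    vertex of the second block in the first as well.\<close>
  have disj: "disjoint_family_on (\<lambda>d. f ` B d) T"
    unfolding disjoint_family_on_def
  proof (intro ballI impI equals0I)
    fix d e s assume de: "d \<in> T" "e \<in> T" "d \<noteq> e" and "s \<in> f ` B d \<inter> f ` B e"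
    then obtain x y where xy: "x \<in> B d" "y \<in> B e" "f x = f y"
      by auto
    moreover have "f x \<noteq> m"
      using xy(1) de(1) by (auto simp: T_def M_def)
    ultimately have "y \<in> B d"
      using partner_in_block[of d "nxt d" x y] de nxt[of d] B_lt[of e y]
      by (auto simp: B_def T_def E'_def)
    with xy de B_disj show False
      by (auto simp: T_def)
  qed
  have "2 ^ card T \<le> (\<Sum>d\<in>T. card (f ` B d)) + 1"
  proof (rule two_power_card_le_sum_card)
    show "finite T"
      using finE' by (simp add: T_def)
    show "finite (f ` B d) \<and> f ` B d \<noteq> {} \<and> 0 \<notin> f ` B d \<and> \<Sum>(f ` B d) \<le> (card (f ` B d))\<^sup>2"
      if d: "d \<in> T" for d
    proof (intro conjI)
      have d': "d \<in> E'" "m \<notin> f ` B d"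
        using d by (auto simp: T_def M_def)
      show "finite (f ` B d)"
        by (simp add: B_def)
      show "f ` B d \<noteq> {}"
        using nxt[OF d'(1)] by (auto simp: B_def)
      show "0 \<notin> f ` B d"
        using f_in B_lt[OF d'(1)] by fastforce
      show "\<Sum>(f ` B d) \<le> (card (f ` B d))\<^sup>2"
        using d' nxt[OF d'(1)] unfolding B_def E'_def by (intro block_sum_le) auto
    qed
  qed (fact disj)
  also have "(\<Sum>d\<in>T. card (f ` B d)) = card (\<Union>d\<in>T. f ` B d)"
    by (rule card_UN_disjoint[symmetric])
      (use finE' disj in \<open>auto simp: T_def B_def disjoint_family_on_def\<close>)
  also have "\<dots> \<le> card {1..m}"
  proof (rule card_mono)
    show "(\<Union>d\<in>T. f ` B d) \<subseteq> {1..m}"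
      using f_in B_lt by (fastforce simp: T_def)
  qed simp
  finally have "2 ^ card T \<le> m + 1"
    by simp
  moreover have "(2::nat) ^ (card ?E - 3) \<le> 2 ^ card T"
    using card_T by (intro power_increasing) auto
  ultimately show ?thesis
    by linarith
qed

end

theorem theorem9:
  shows "\<exists>K::real. \<forall>m::nat. m \<ge> 2 \<longrightarrow>
           (\<forall>f. skolem_circle m f \<longrightarrow> real (card (removable_edges m f)) \<le> K * ln (real m))"
proof (intro exI[of _ "5 / ln 2"] allI impI)
  fix m :: nat and f assume m: "m \<ge> 2" and "skolem_circle m f"
  then interpret skolem m f
    by unfold_locales
  \<comment> \<open>The constant 5 is 2 + 3: \<open>r * ln 2\<close> is at most
    \<open>2 * ln m\<close> because \<open>m + 1\<close> is at most the square of \<open>m\<close>,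
    and the remaining \<open>3 * ln 2\<close> is at most \<open>3 * ln m\<close>.\<close>
  define r where "r = card (cuts m f) - 3"
  have "2 ^ r \<le> m + 1"
    unfolding r_def by (rule two_power_card_cuts_le)
  also have "m + 1 \<le> m ^ 2"
    using m mult_le_mono1[of 2 m m] unfolding power2_eq_square by linarith
  finally have "real (2 ^ r) \<le> real (m ^ 2)"
    by (simp only: of_nat_le_iff)
  then have "ln (2 ^ r) \<le> ln (real m ^ 2)"
    using m by (subst ln_le_cancel_iff) auto
  then have "real r * ln 2 \<le> 2 * ln (real m)"
    using m by (simp add: ln_realpow)
  moreover have "ln 2 \<le> ln (real m)"
    using m by simp
  ultimately have "(real r + 3) * ln 2 \<le> 5 * ln (real m)"
    by (simp add: algebra_simps)
  then have "real r + 3 \<le> 5 / ln 2 * ln (real m)"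
    by (simp add: pos_le_divide_eq)
  moreover have "card (removable_edges m f) \<le> r + 3"
    using card_removable_edges_le[of m f] by (simp add: r_def)
  then have "real (card (removable_edges m f)) \<le> real r + 3"
    by simp
  ultimately show "real (card (removable_edges m f)) \<le> 5 / ln 2 * ln (real m)"
    by linarith
qed

end
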